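(* Let $\mathbb{T}$ be a time scale, let $\alpha,\beta\in\mathbb{T}$ with $\alpha<\beta$, and let $\psi,\phi:[\alpha,\beta]_{\mathbb{T}}\to(0,\infty)$ be functions such that the Delta integrals below converge. If $\psi/\phi$ is increasing (respectively, decreasing) on $[\alpha,\beta]_{\mathbb{T}}$, then the function $$s\mapsto\frac{\int_\alpha^\beta \psi(\upsilon)s^\upsilon\,\Delta\upsilon}{\int_\alpha^\beta \phi(\upsilon)s^\upsilon\,\Delta\upsilon}$$ is increasing (respectively, decreasing) for $s\in(0,\infty)$.
   Context: A time scale $\mathbb{T}$ is a nonempty closed subset of $\mathbb{R}$, and $[\alpha,\beta]_{\mathbb{T}}=[\alpha,\beta]\cap\mathbb{T}$. The Delta integral $\int_a^b f(\upsilon)\,\Delta\upsilon$ ($a\le b$ in $\mathbb{T}$) is the standard one, i.e. the integral of $f$ over $[a,b)\cap\mathbb{T}$ with respect to the Delta measure $\mu_\Delta$ on $\mathbb{T}$, determined by $\mu_\Delta([c,d)\cap\mathbb{T})=d-c$ for $c\le d$ in $\mathbb{T}$. "Increasing" and "decreasing" are meant in the non-strict sense. *)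

theory Defs
  imports "HOL-Analysis.Analysis"
begin

definition time_scale :: "real set \<Rightarrow> bool" where
  "time_scale T \<longleftrightarrow> T \<noteq> {} \<and> closed T"

text \<open>
  The values on the half-open intervals determine the measure on every bounded
  \<open>{a..<b} \<inter> T\<close> with \<open>a\<close> and \<open>b\<close> in \<open>T\<close>. They do not determine the mass of a greatest
  element of \<open>T\<close>; Delta integrals never see that point.
  The completion makes all Lebesgue Delta-measurable functions (not only the Borel ones)
  admissible as integrands.
\<close>
definition delta_measure :: "real set \<Rightarrow> real measure" where
  "delta_measure T = completion (extend_measure T {(c, d). c \<in> T \<and> d \<in> T \<and> c \<le> d}
     (\<lambda>(c, d). {c..<d} \<inter> T) (\<lambda>(c, d). ennreal (d - c)))"

definition delta_integrable :: "real set \<Rightarrow> real \<Rightarrow> real \<Rightarrow> (real \<Rightarrow> real) \<Rightarrow> bool" where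
  "delta_integrable T a b f \<longleftrightarrow> set_integrable (delta_measure T) ({a..<b} \<inter> T) f"

definition delta_integral :: "real set \<Rightarrow> real \<Rightarrow> real \<Rightarrow> (real \<Rightarrow> real) \<Rightarrow> real" where
  "delta_integral T a b f = set_lebesgue_integral (delta_measure T) ({a..<b} \<inter> T) f"

text \<open>
  \<^const>\<open>extend_measure\<close> returns the zero measure if no measure with the prescribed values
  exists. It does exist for a time scale: push Lebesgue measure forward along
  \<open>x \<mapsto> Sup (T \<inter> {..x})\<close>.
\<close>
lemma emeasure_delta_measure:
  assumes T: "time_scale T" and cd: "c \<in> T" "d \<in> T" "c \<le> d"
  shows "{c..<d} \<inter> T \<in> sets (delta_measure T)"
    and "emeasure (delta_measure T) ({c..<d} \<inter> T) = ennreal (d - c)"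
proof -
  let ?I = "{(c, d). c \<in> T \<and> d \<in> T \<and> c \<le> d}"
  let ?G = "\<lambda>(c, d). {c..<d} \<inter> T"
  define M where "M = extend_measure T ?I ?G (\<lambda>(c, d). ennreal (d - c))"
  have GT: "?G ` ?I \<subseteq> Pow T" by auto
  have setsM: "sets M = sigma_sets T (?G ` ?I)"
    unfolding M_def by (rule sets_extend_measure[OF GT])
  have spaceM: "space M = T"
    unfolding M_def by (rule space_extend_measure[OF GT])
  have inM: "{u..<v} \<inter> T \<in> sets M" if "u \<in> T" "v \<in> T" "u \<le> v" for u v
    unfolding setsM by (rule sigma_sets.Basic) (use that in force)
  define S where "S = {x. \<exists>t\<in>T. t \<le> x}"
  define F where "F x = Sup (T \<inter> {..x})" for x
  have clT: "closed T" using T by (simp add: time_scale_def)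
  have bdd: "bdd_above (T \<inter> {..x})" for x by (rule bdd_aboveI[of _ x]) auto
  have F_in: "F x \<in> T \<inter> {..x}" if "x \<in> S" for x
    unfolding F_def
    by (rule closed_contains_Sup) (use that bdd clT in \<open>auto simp: S_def\<close>)
  have F_ge: "t \<le> F x" if "t \<in> T" "t \<le> x" for t x
    unfolding F_def by (rule cSup_upper) (use that bdd in auto)
  have S_borel: "S \<in> sets lborel"
  proof (cases "bdd_below T")
    case True
    then have "Inf T \<in> T" "\<And>t. t \<in> T \<Longrightarrow> Inf T \<le> t"
      using T by (auto simp: time_scale_def intro: closed_contains_Inf cInf_lower)
    then have "S = {Inf T..}" by (force simp: S_def)
    then show ?thesis by simp
  next
    case False
    then have "S = UNIV" by (auto simp: S_def bdd_below_def not_le intro: less_imp_le)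
    then show ?thesis by simp
  qed
  have pre: "F -` ({u..<v} \<inter> T) \<inter> S = {u..<v}" if uv: "u \<in> T" "v \<in> T" for u v
  proof (intro equalityI subsetI)
    fix x assume x: "x \<in> F -` ({u..<v} \<inter> T) \<inter> S"
    then have "F x \<le> x" "u \<le> F x" "F x < v" using F_in[of x] by auto
    moreover have "x < v" using F_ge[of v x] uv \<open>F x < v\<close> by (meson not_le)
    ultimately show "x \<in> {u..<v}" by auto
  next
    fix x assume x: "x \<in> {u..<v}"
    then have "x \<in> S" using uv by (auto simp: S_def)
    then show "x \<in> F -` ({u..<v} \<inter> T) \<inter> S"
      using x uv F_in[of x] F_ge[of u x] by auto
  qed
  define R where "R = restrict_space lborel S"
  have spaceR: "space R = S" by (simp add: R_def space_restrict_space)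
  have meas: "F \<in> measurable R M"
  proof (rule measurable_sigma_sets[OF setsM GT])
    show "F \<in> space R \<rightarrow> T" using F_in by (auto simp: spaceR)
    fix A assume "A \<in> ?G ` ?I"
    then obtain u v where uv: "u \<in> T" "v \<in> T" and A: "A = {u..<v} \<inter> T" by auto
    have "{u..<v} \<subseteq> S" using uv by (auto simp: S_def)
    then have "{u..<v} \<in> sets R"
      using S_borel unfolding R_def by (simp add: sets_restrict_space_iff)
    then show "F -` A \<inter> space R \<in> sets R"
      unfolding spaceR A pre[OF uv] .
  qed
  define D where "D = distr R M F"
  have D: "emeasure D ({u..<v} \<inter> T) = ennreal (v - u)" if uv: "u \<in> T" "v \<in> T" "u \<le> v" for u v
  proof -
    have "{u..<v} \<subseteq> S" using uv by (auto simp: S_def)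
    then have "emeasure R {u..<v} = ennreal (v - u)"
      using S_borel uv by (simp add: R_def emeasure_restrict_space)
    then show ?thesis
      unfolding D_def emeasure_distr[OF meas inM[OF uv]] spaceR pre[OF uv(1,2)] .
  qed
  have setsD: "sets D = sets M" by (simp add: D_def)
  have "emeasure M (?G (c, d)) = (\<lambda>(c, d). ennreal (d - c)) (c, d)"
  proof (rule emeasure_extend_measure[OF M_def _ GT])
    show "positive (sets M) (emeasure D)" "countably_additive (sets M) (emeasure D)"
      using emeasure_positive[of D] emeasure_countably_additive[of D] by (simp_all add: setsD)
    show "(c, d) \<in> ?I" using cd by simp
    show "emeasure D (?G i) = (\<lambda>(c, d). ennreal (d - c)) i" if "i \<in> ?I" for i
      using that D by auto
  qed
  moreover have "delta_measure T = completion M" by (simp add: delta_measure_def M_def)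
  ultimately show "{c..<d} \<inter> T \<in> sets (delta_measure T)"
    and "emeasure (delta_measure T) ({c..<d} \<inter> T) = ennreal (d - c)"
    using inM[OF cd] by simp_all
qed

end

(* The claim is Chebyshev's integral inequality in cross-multiplied form: the integrand
   (psi x phi y - psi y phi x) (t^x s^y - t^y s^x) is nonnegative for s <= t since psi/phi and
   (t/s)^x are both monotone, and integrating it in x and then in y gives twice the difference of
   the cross products. The integrand is a sum of products of functions of one variable, so no
   Fubini theorem (and no sigma-finiteness) is needed. The decreasing case is the increasing one
   with psi and phi exchanged. *)

theory Submission
  imports Defs
begin

text \<open>The product in \<open>nonneg\<close> expands into four terms, each a function of
  \<open>x\<close> times a function of \<open>y\<close>. Integrating it in one variable therefore
  takes only linearity and the four integrals from \<open>int\<close>, over an arbitrary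
  measure.\<close>

lemma chebyshev_set_integral:
  fixes f g u v :: "'a \<Rightarrow> real"
  assumes int: "set_integrable M S (\<lambda>x. f x * u x)" "set_integrable M S (\<lambda>x. f x * v x)"
      "set_integrable M S (\<lambda>x. g x * u x)" "set_integrable M S (\<lambda>x. g x * v x)"
    and nonneg: "\<And>x y. x \<in> S \<Longrightarrow> y \<in> S \<Longrightarrow> 0 \<le> (f x * g y - f y * g x) * (u x * v y - u y * v x)"
  shows "(LINT x:S|M. f x * v x) * (LINT x:S|M. g x * u x)
       \<le> (LINT x:S|M. f x * u x) * (LINT x:S|M. g x * v x)"
proof -
  define FU where "FU = (LINT x:S|M. f x * u x)"
  define FV where "FV = (LINT x:S|M. f x * v x)"
  define GU where "GU = (LINT x:S|M. g x * u x)"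
  define GV where "GV = (LINT x:S|M. g x * v x)"
  note defs = FU_def FV_def GU_def GV_def
  \<comment> \<open>Serves both integrations: first the coefficients are values at a fixed
    \<open>y\<close>, then they are the integrals \<open>GV\<close>, \<open>GU\<close>,
    \<open>FV\<close>, \<open>FU\<close>.\<close>
  have lin: "(LINT x:S|M. a * (f x * u x) - b * (f x * v x) - c * (g x * u x) + d * (g x * v x))
      = a * FU - b * FV - c * GU + d * GV" for a b c d
    using int by (simp add: defs)
  have inner: "0 \<le> g y * v y * FU - g y * u y * FV - f y * v y * GU + f y * u y * GV"
    if y: "y \<in> S" for y
  proof -
    have "0 \<le> (LINT x:S|M. (g y * v y) * (f x * u x) - (g y * u y) * (f x * v x)
        - (f y * v y) * (g x * u x) + (f y * u y) * (g x * v x))"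
      unfolding set_lebesgue_integral_def
      by (rule Bochner_Integration.integral_nonneg)
         (use nonneg[OF _ y] in \<open>auto simp: indicator_def algebra_simps\<close>)
    then show ?thesis unfolding lin .
  qed
  \<comment> \<open>The bound \<open>inner\<close>, reordered as a function of \<open>y\<close>. By
    \<open>lin\<close> this integral equals \<open>2 * (FU * GV - FV * GU)\<close>.\<close>
  have "0 \<le> (LINT y:S|M. GV * (f y * u y) - GU * (f y * v y) - FV * (g y * u y) + FU * (g y * v y))"
    unfolding set_lebesgue_integral_def
    by (rule Bochner_Integration.integral_nonneg) (use inner in \<open>auto simp: indicator_def algebra_simps\<close>)
  then show ?thesis unfolding lin unfolding defs[symmetric] by (simp add: algebra_simps)
qed

text \<open>A nonnegative integrand with integral zero vanishes almost everywhere; as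
  \<open>f\<close> is positive on \<open>S\<close>, this would make \<open>S\<close> a null
  set.\<close>

lemma set_integral_pos:
  fixes f :: "'a \<Rightarrow> real"
  assumes S: "S \<in> sets M" "emeasure M S \<noteq> 0"
    and int: "set_integrable M S f" and pos: "\<And>x. x \<in> S \<Longrightarrow> 0 < f x"
  shows "0 < (LINT x:S|M. f x)"
proof -
  have nonneg: "0 \<le> indicator S x * f x" for x
    using pos[of x] by (auto simp: indicator_def)
  have "(LINT x:S|M. f x) \<noteq> 0"
  proof
    assume "(LINT x:S|M. f x) = 0"
    then have "AE x in M. indicator S x * f x = 0"
      using integral_nonneg_eq_0_iff_AE[of M "\<lambda>x. indicator S x * f x"] int nonneg
      by (simp add: set_integrable_def set_lebesgue_integral_def)
    then have "AE x in M. x \<notin> S"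
      by (rule AE_mp) (use pos in \<open>force intro!: AE_I2\<close>)
    then show False
      using S AE_iff_null_sets[OF S(1)] by auto
  qed
  moreover have "0 \<le> (LINT x:S|M. f x)"
    unfolding set_lebesgue_integral_def by (rule Bochner_Integration.integral_nonneg) (use nonneg in simp)
  ultimately show ?thesis by simp
qed

text \<open>Division by \<open>t powr x * s powr x\<close> leaves
  \<open>s powr (y - x) \<le> t powr (y - x)\<close>, where the exponent is nonnegative.\<close>

lemma powr_cross_mono:
  fixes s t x y :: real
  assumes "0 < s" "s \<le> t" "x \<le> y"
  shows "t powr x * s powr y \<le> t powr y * s powr x"
proof -
  have "s powr (y - x) \<le> t powr (y - x)"
    using assms by (intro powr_mono2) auto
  then have "(t powr x * s powr x) * s powr (y - x) \<le> (t powr x * s powr x) * t powr (y - x)"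
    by (intro mult_left_mono) auto
  then show ?thesis
    using assms by (simp add: powr_diff field_simps)
qed

text \<open>The domain of integration has Delta measure \<open>\<beta> - \<alpha>\<close>, so it is
  not a null set.\<close>

lemma delta_integral_pos:
  assumes "time_scale T" "\<alpha> \<in> T" "\<beta> \<in> T" "\<alpha> < \<beta>"
    and "delta_integrable T \<alpha> \<beta> f" and "\<And>x. x \<in> {\<alpha>..\<beta>} \<inter> T \<Longrightarrow> 0 < f x"
  shows "0 < delta_integral T \<alpha> \<beta> f"
  unfolding delta_integral_def
  by (rule set_integral_pos)
     (use assms emeasure_delta_measure[of T \<alpha> \<beta>] in \<open>auto simp: delta_integrable_def\<close>)

text \<open>Monotonicity of \<open>f / g\<close> enters in cross-multiplied form, so that the pair
  can be taken as \<open>\<psi>\<close>, \<open>\<phi>\<close> or in the opposite order.\<close>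

lemma delta_integral_powr_cross_le:
  assumes cross: "\<And>x y. x \<in> {\<alpha>..\<beta>} \<inter> T \<Longrightarrow> y \<in> {\<alpha>..\<beta>} \<inter> T \<Longrightarrow> x \<le> y \<Longrightarrow> f x * g y \<le> f y * g x"
    and f: "\<And>s. 0 < s \<Longrightarrow> delta_integrable T \<alpha> \<beta> (\<lambda>x. f x * s powr x)"
    and g: "\<And>s. 0 < s \<Longrightarrow> delta_integrable T \<alpha> \<beta> (\<lambda>x. g x * s powr x)"
    and st: "0 < s" "s \<le> t"
  shows "delta_integral T \<alpha> \<beta> (\<lambda>x. f x * s powr x) * delta_integral T \<alpha> \<beta> (\<lambda>x. g x * t powr x)
       \<le> delta_integral T \<alpha> \<beta> (\<lambda>x. f x * t powr x) * delta_integral T \<alpha> \<beta> (\<lambda>x. g x * s powr x)"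
  unfolding delta_integral_def
\<comment> \<open>Here \<open>u\<close> is \<open>\<lambda>x. t powr x\<close> and \<open>v\<close>
  is \<open>\<lambda>x. s powr x\<close>.\<close>
proof (rule chebyshev_set_integral)
  fix x y assume xy: "x \<in> {\<alpha>..<\<beta>} \<inter> T" "y \<in> {\<alpha>..<\<beta>} \<inter> T"
  show "0 \<le> (f x * g y - f y * g x) * (t powr x * s powr y - t powr y * s powr x)"
  \<comment> \<open>Exchanging \<open>x\<close> and \<open>y\<close> flips the sign of both factors:
    they are both nonpositive for \<open>x \<le> y\<close> and both nonnegative otherwise.\<close>
  proof (cases "x \<le> y")
    case True
    then show ?thesis
      using cross[of x y] powr_cross_mono[OF st True] xy by (intro mult_nonpos_nonpos) auto
  next
    case False
    then show ?thesis
      using cross[of y x] powr_cross_mono[OF st, of y x] xy by (intro mult_nonneg_nonneg) auto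
  qed
qed (use f g st in \<open>auto simp: delta_integrable_def\<close>)

theorem theorem3p1:
  fixes T :: "real set" and \<alpha> \<beta> :: real and \<psi> \<phi> :: "real \<Rightarrow> real"
  assumes "time_scale T"
    and "\<alpha> \<in> T" and "\<beta> \<in> T" and "\<alpha> < \<beta>"
    and "\<And>\<upsilon>. \<upsilon> \<in> {\<alpha>..\<beta>} \<inter> T \<Longrightarrow> \<psi> \<upsilon> > 0"
    and "\<And>\<upsilon>. \<upsilon> \<in> {\<alpha>..\<beta>} \<inter> T \<Longrightarrow> \<phi> \<upsilon> > 0"
    and "\<And>s. s > 0 \<Longrightarrow> delta_integrable T \<alpha> \<beta> (\<lambda>\<upsilon>. \<psi> \<upsilon> * s powr \<upsilon>)"
    and "\<And>s. s > 0 \<Longrightarrow> delta_integrable T \<alpha> \<beta> (\<lambda>\<upsilon>. \<phi> \<upsilon> * s powr \<upsilon>)"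
  shows "(mono_on ({\<alpha>..\<beta>} \<inter> T) (\<lambda>\<upsilon>. \<psi> \<upsilon> / \<phi> \<upsilon>) \<longrightarrow>
           mono_on {0<..} (\<lambda>s. delta_integral T \<alpha> \<beta> (\<lambda>\<upsilon>. \<psi> \<upsilon> * s powr \<upsilon>) /
                                delta_integral T \<alpha> \<beta> (\<lambda>\<upsilon>. \<phi> \<upsilon> * s powr \<upsilon>))) \<and>
         (antimono_on ({\<alpha>..\<beta>} \<inter> T) (\<lambda>\<upsilon>. \<psi> \<upsilon> / \<phi> \<upsilon>) \<longrightarrow>
           antimono_on {0<..} (\<lambda>s. delta_integral T \<alpha> \<beta> (\<lambda>\<upsilon>. \<psi> \<upsilon> * s powr \<upsilon>) /
                                    delta_integral T \<alpha> \<beta> (\<lambda>\<upsilon>. \<phi> \<upsilon> * s powr \<upsilon>)))"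
proof -
  let ?A = "\<lambda>s. delta_integral T \<alpha> \<beta> (\<lambda>\<upsilon>. \<psi> \<upsilon> * s powr \<upsilon>)"
  let ?B = "\<lambda>s. delta_integral T \<alpha> \<beta> (\<lambda>\<upsilon>. \<phi> \<upsilon> * s powr \<upsilon>)"
  \<comment> \<open>Positive denominators turn the comparison of quotients into one of cross
    products.\<close>
  have B_pos: "0 < ?B s" if "0 < s" for s
    using assms that by (intro delta_integral_pos) auto
  have "?A s / ?B s \<le> ?A t / ?B t"
    if mono: "mono_on ({\<alpha>..\<beta>} \<inter> T) (\<lambda>\<upsilon>. \<psi> \<upsilon> / \<phi> \<upsilon>)" and st: "0 < s" "s \<le> t" for s t
  proof -
    have "\<psi> x * \<phi> y \<le> \<psi> y * \<phi> x"
      if "x \<in> {\<alpha>..\<beta>} \<inter> T" "y \<in> {\<alpha>..\<beta>} \<inter> T" "x \<le> y" for x y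
      using mono_onD[OF mono that] assms(6)[OF that(1)] assms(6)[OF that(2)]
      by (simp add: divide_simps mult.commute)
    from delta_integral_powr_cross_le[OF this assms(7,8) st]
    show ?thesis using B_pos[of s] B_pos[of t] st by (simp add: divide_simps mult.commute)
  qed
  moreover have "?A t / ?B t \<le> ?A s / ?B s"
    if anti: "antimono_on ({\<alpha>..\<beta>} \<inter> T) (\<lambda>\<upsilon>. \<psi> \<upsilon> / \<phi> \<upsilon>)" and st: "0 < s" "s \<le> t" for s t
  proof -
    have "\<phi> x * \<psi> y \<le> \<phi> y * \<psi> x"
      if "x \<in> {\<alpha>..\<beta>} \<inter> T" "y \<in> {\<alpha>..\<beta>} \<inter> T" "x \<le> y" for x y
      using monotone_onD[OF anti that] assms(6)[OF that(1)] assms(6)[OF that(2)]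
      by (simp add: divide_simps mult.commute)
    \<comment> \<open>With the roles exchanged this reads
      \<open>?B s * ?A t \<le> ?B t * ?A s\<close>; dividing by \<open>?B s * ?B t\<close> gives the
      reversed comparison of the original quotients.\<close>
    from delta_integral_powr_cross_le[OF this assms(8,7) st]
    show ?thesis using B_pos[of s] B_pos[of t] st by (simp add: divide_simps mult.commute)
  qed
  ultimately show ?thesis
    by (auto intro!: monotone_onI)
qed

end
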